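(* Let $\mathcal H$ be a real Hilbert space and let $A,B:\mathcal H\rightrightarrows\mathcal H$ be maximal monotone operators with $(A+B)^{-1}(0)\neq\emptyset$. Let $\{z_k\}$, $\{(x_k,b_k)\}$, $\{\varepsilon_{b,k}\}$ and $\{(y_k,a_k)\}$ be generated by Algorithm 3 (described in the context) with input $z_0\in\mathcal H$, $\gamma>0$, $\tau_0>0$, $0<\sigma,\theta<1$, and let $\{k_j\}_{j\in J}$ be the increasing enumeration of its extragradient steps, with $k_0:=0$. Define, for all $j\in J$, $$\widetilde z_{k_j}:=y_{k_j}+\gamma b_{k_j},\qquad v_{k_j}:=\gamma(a_{k_j}+b_{k_j}),\qquad \varepsilon_{k_j}:=\gamma\varepsilon_{b,k_j}.$$ Then, for all $j\in J$, $$v_{k_j}\in(S_{\gamma,A,B})^{\varepsilon_{k_j}}(\widetilde z_{k_j}),\qquad \|v_{k_j}+\widetilde z_{k_j}-z_{k_{j-1}}\|^2+2\varepsilon_{k_j}\le\sigma^2\|\widetilde z_{k_j}-z_{k_{j-1}}\|^2,\qquad z_{k_j}=z_{k_{j-1}}-v_{k_j}.$$ As a consequence, the sequences $\{\widetilde z_{k_j}\}_{j\in J}$, $\{v_{k_j}\}_{j\in J}$, $\{\varepsilon_{k_j}\}_{j\in J}$ and $\{z_{k_j}\}_{j\in J}$ are generated by the HPE method (Algorithm 1, described in the context) with $\lambda_j\equiv1$ for solving $0\in T(z)$ with $T:=S_{\gamma,A,B}$.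
   Context: Enlargement: for $T:\mathcal H\rightrightarrows\mathcal H$ and $\varepsilon\ge0$, $T^{\varepsilon}(z):=\{v\in\mathcal H : \langle z-z',v-v'\rangle\ge-\varepsilon\ \text{for all } z',v' \text{ with } v'\in T(z')\}$. Operator $S_{\gamma,A,B}$: the maximal monotone operator on $\mathcal H$ with graph $\{(y+\gamma b,\gamma a+\gamma b) : b\in B(x),\ a\in A(y),\ \gamma a+y=x-\gamma b\}$. Algorithm 1 (hybrid proximal extragradient, HPE, method for $0\in T(z)$, $T$ maximal monotone). Given $z_0\in\mathcal H$ and $\sigma\in[0,1)$, for $j=1,2,\dots$: compute $(\widetilde z_j,v_j,\varepsilon_j)\in\mathcal H\times\mathcal H\times\mathbb R_+$ and $\lambda_j>0$ such that $v_j\in T^{\varepsilon_j}(\widetilde z_j)$ and $\|\lambda_jv_j+\widetilde z_j-z_{j-1}\|^2+2\lambda_j\varepsilon_j\le\sigma^2\|\widetilde z_j-z_{j-1}\|^2$; set $z_j=z_{j-1}-\lambda_jv_j$. Algorithm 3 (inexact Douglas-Rachford splitting). Input $z_0\in\mathcal H$, $\gamma>0$, $\tau_0>0$, $0<\sigma,\theta<1$. For $k=1,2,\dots$: (1) compute (any) $(x_k,b_k,\varepsilon_{b,k})\in\mathcal H\times\mathcal H\times\mathbb R_+$ with $b_k\in B^{\varepsilon_{b,k}}(x_k)$ and $\|\gamma b_k+x_k-z_{k-1}\|^2+2\gamma\varepsilon_{b,k}\le\tau_{k-1}$; (2) compute $(y_k,a_k)$ with $a_k\in A(y_k)$ and $\gamma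 a_k+y_k=x_k-\gamma b_k$; (3) if $\|\gamma b_k+x_k-z_{k-1}\|^2+2\gamma\varepsilon_{b,k}\le\sigma^2\|\gamma b_k+y_k-z_{k-1}\|^2$, set $z_k=z_{k-1}-\gamma(a_k+b_k)$, $\tau_k=\tau_{k-1}$ (extragradient step); otherwise set $z_k=z_{k-1}$, $\tau_k=\theta\tau_{k-1}$ (null step). Index sets: $\mathcal A$ is the set of $k\ge1$ at which an extragradient step is executed; $J:=\{j\ge1 : j\le\#\mathcal A\}$ and $\mathcal A=\{k_j\}_{j\in J}$ with $0=k_0<k_1<k_2<\cdots$. *)

theory Defs
  imports "HOL-Analysis.Analysis"
begin

text \<open>
  A set-valued operator on a real Hilbert space \<open>'h\<close> (sort \<open>{real_inner, complete_space}\<close>)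
  is a function \<open>'h \<Rightarrow> 'h set\<close>; its graph is the set of pairs \<open>(z, v)\<close> with \<open>v \<in> T z\<close>.
\<close>

definition op_plus :: "('h::real_inner \<Rightarrow> 'h set) \<Rightarrow> ('h \<Rightarrow> 'h set) \<Rightarrow> 'h \<Rightarrow> 'h set" where
  "op_plus A B x = {u + w | u w. u \<in> A x \<and> w \<in> B x}"

definition op_inverse :: "('h \<Rightarrow> 'h set) \<Rightarrow> 'h \<Rightarrow> 'h set" where
  "op_inverse T v = {z. v \<in> T z}"

definition monotone_operator :: "('h::real_inner \<Rightarrow> 'h set) \<Rightarrow> bool" where
  "monotone_operator T \<longleftrightarrow>
     (\<forall>z z' v v'. v \<in> T z \<longrightarrow> v' \<in> T z' \<longrightarrow> (z - z') \<bullet> (v - v') \<ge> 0)"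

definition maximal_monotone :: "('h::real_inner \<Rightarrow> 'h set) \<Rightarrow> bool" where
  "maximal_monotone T \<longleftrightarrow> monotone_operator T \<and>
     (\<forall>T'. monotone_operator T' \<longrightarrow> (\<forall>z. T z \<subseteq> T' z) \<longrightarrow> T' = T)"

text \<open>Used only for \<open>\<epsilon> \<ge> 0\<close>; the algorithms below impose this sign condition explicitly.\<close>

definition enlargement :: "('h::real_inner \<Rightarrow> 'h set) \<Rightarrow> real \<Rightarrow> 'h \<Rightarrow> 'h set" where
  "enlargement T \<epsilon> z = {v. \<forall>z' v'. v' \<in> T z' \<longrightarrow> (z - z') \<bullet> (v - v') \<ge> - \<epsilon>}"

definition S_graph ::
    "real \<Rightarrow> ('h::real_inner \<Rightarrow> 'h set) \<Rightarrow> ('h \<Rightarrow> 'h set) \<Rightarrow> ('h \<times> 'h) set" where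
  "S_graph \<gamma> A B =
     {(y + \<gamma> *\<^sub>R b, \<gamma> *\<^sub>R a + \<gamma> *\<^sub>R b) | x y a b.
        b \<in> B x \<and> a \<in> A y \<and> \<gamma> *\<^sub>R a + y = x - \<gamma> *\<^sub>R b}"

definition S_operator ::
    "real \<Rightarrow> ('h::real_inner \<Rightarrow> 'h set) \<Rightarrow> ('h \<Rightarrow> 'h set) \<Rightarrow> 'h \<Rightarrow> 'h set" where
  "S_operator \<gamma> A B z = {v. (z, v) \<in> S_graph \<gamma> A B}"

text \<open>
  The hybrid proximal extragradient method for \<open>0 \<in> T z\<close>, run over the iteration indices \<open>J\<close>:
  either all \<open>j \<ge> 1\<close> or an initial segment \<open>{1..n}\<close>, possibly empty. The starting point
  \<open>z\<^sub>0\<close> is the value of the sequence \<open>z\<close> at \<open>0\<close>. That \<open>T\<close> is maximal monotone is part of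
  the method and hence of this predicate.
\<close>

definition hpe_method ::
    "('h::real_inner \<Rightarrow> 'h set) \<Rightarrow> real \<Rightarrow> 'h \<Rightarrow> nat set \<Rightarrow> (nat \<Rightarrow> real) \<Rightarrow>
     (nat \<Rightarrow> 'h) \<Rightarrow> (nat \<Rightarrow> 'h) \<Rightarrow> (nat \<Rightarrow> real) \<Rightarrow> (nat \<Rightarrow> 'h) \<Rightarrow> bool" where
  "hpe_method T \<sigma> z0 J lam zt v \<epsilon> z \<longleftrightarrow>
     maximal_monotone T \<and> 0 \<le> \<sigma> \<and> \<sigma> < 1 \<and>
     (\<forall>j\<in>J. 1 \<le> j \<and> {1..j} \<subseteq> J) \<and>
     z 0 = z0 \<and>
     (\<forall>j\<in>J. \<epsilon> j \<ge> 0 \<and> lam j > 0 \<and>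
        v j \<in> enlargement T (\<epsilon> j) (zt j) \<and>
        (norm (lam j *\<^sub>R v j + zt j - z (j - 1)))\<^sup>2 + 2 * lam j * \<epsilon> j
          \<le> \<sigma>\<^sup>2 * (norm (zt j - z (j - 1)))\<^sup>2 \<and>
        z j = z (j - 1) - lam j *\<^sub>R v j)"

definition extragradient_test ::
    "real \<Rightarrow> real \<Rightarrow> (nat \<Rightarrow> 'h::real_inner) \<Rightarrow> (nat \<Rightarrow> 'h) \<Rightarrow> (nat \<Rightarrow> 'h) \<Rightarrow>
     (nat \<Rightarrow> real) \<Rightarrow> (nat \<Rightarrow> 'h) \<Rightarrow> nat \<Rightarrow> bool" where
  "extragradient_test \<gamma> \<sigma> z x b \<epsilon>b y k \<longleftrightarrow>
     (norm (\<gamma> *\<^sub>R b k + x k - z (k - 1)))\<^sup>2 + 2 * \<gamma> * \<epsilon>b k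
       \<le> \<sigma>\<^sup>2 * (norm (\<gamma> *\<^sub>R b k + y k - z (k - 1)))\<^sup>2"

text \<open>
  The inexact Douglas-Rachford method: an iteration is an extragradient step if the test holds,
  and a null step otherwise. The values at index \<open>0\<close> of \<open>x\<close>, \<open>b\<close>, \<open>\<epsilon>b\<close>, \<open>y\<close>, \<open>a\<close> are irrelevant.
\<close>

definition inexact_DR ::
    "('h::real_inner \<Rightarrow> 'h set) \<Rightarrow> ('h \<Rightarrow> 'h set) \<Rightarrow>
     'h \<Rightarrow> real \<Rightarrow> real \<Rightarrow> real \<Rightarrow> real \<Rightarrow>
     (nat \<Rightarrow> 'h) \<Rightarrow> (nat \<Rightarrow> 'h) \<Rightarrow> (nat \<Rightarrow> 'h) \<Rightarrow> (nat \<Rightarrow> real) \<Rightarrow>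
     (nat \<Rightarrow> 'h) \<Rightarrow> (nat \<Rightarrow> 'h) \<Rightarrow> (nat \<Rightarrow> real) \<Rightarrow> bool" where
  "inexact_DR A B z0 \<gamma> \<tau>0 \<sigma> \<theta> z x b \<epsilon>b y a \<tau> \<longleftrightarrow>
     z 0 = z0 \<and> \<tau> 0 = \<tau>0 \<and>
     (\<forall>k\<ge>1.
        \<epsilon>b k \<ge> 0 \<and> b k \<in> enlargement B (\<epsilon>b k) (x k) \<and>
        (norm (\<gamma> *\<^sub>R b k + x k - z (k - 1)))\<^sup>2 + 2 * \<gamma> * \<epsilon>b k \<le> \<tau> (k - 1) \<and>
        a k \<in> A (y k) \<and> \<gamma> *\<^sub>R a k + y k = x k - \<gamma> *\<^sub>R b k \<and>
        (if extragradient_test \<gamma> \<sigma> z x b \<epsilon>b y k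
         then z k = z (k - 1) - \<gamma> *\<^sub>R (a k + b k) \<and> \<tau> k = \<tau> (k - 1)
         else z k = z (k - 1) \<and> \<tau> k = \<theta> * \<tau> (k - 1)))"

definition extragradient_steps ::
    "real \<Rightarrow> real \<Rightarrow> (nat \<Rightarrow> 'h::real_inner) \<Rightarrow> (nat \<Rightarrow> 'h) \<Rightarrow> (nat \<Rightarrow> 'h) \<Rightarrow>
     (nat \<Rightarrow> real) \<Rightarrow> (nat \<Rightarrow> 'h) \<Rightarrow> nat set" where
  "extragradient_steps \<gamma> \<sigma> z x b \<epsilon>b y = {k. 1 \<le> k \<and> extragradient_test \<gamma> \<sigma> z x b \<epsilon>b y k}"

text \<open>
  \<open>{j \<ge> 1. j \<le> #\<A>}\<close>, where \<open>#\<A>\<close> may be infinite (\<open>card\<close> is \<open>0\<close> on infinite sets).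
\<close>

definition index_set :: "nat set \<Rightarrow> nat set" where
  "index_set \<A> = {j. 1 \<le> j \<and> (finite \<A> \<longrightarrow> j \<le> card \<A>)}"

text \<open>
  \<open>kk\<close> enumerates \<open>\<A>\<close> increasingly over \<open>index_set \<A>\<close>, with the convention \<open>kk 0 = 0\<close>;
  its values outside \<open>insert 0 (index_set \<A>)\<close> are unconstrained.
\<close>

definition increasing_enumeration :: "nat set \<Rightarrow> (nat \<Rightarrow> nat) \<Rightarrow> bool" where
  "increasing_enumeration \<A> kk \<longleftrightarrow>
     kk 0 = 0 \<and> strict_mono_on (insert 0 (index_set \<A>)) kk \<and> kk ` index_set \<A> = \<A>"

end

theory Submission
  imports Defs
begin

text \<open>
  The enlargement inclusion for \<open>S\<close> rests on the identity
  \<open>\<langle>\<Delta>y + \<gamma>\<Delta>b, \<gamma>\<Delta>a + \<gamma>\<Delta>b\<rangle> = \<gamma>\<langle>\<Delta>y, \<Delta>a\<rangle> + \<gamma>\<langle>\<Delta>x, \<Delta>b\<rangle>\<close>, valid when \<open>\<Delta>x = \<Delta>y + \<gamma>\<Delta>a + \<gamma>\<Delta>b\<close>; the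
  error criterion is the extragradient test itself, because the iterate does not move during
  null steps.

  Maximality of \<open>S\<close> follows from surjectivity of \<open>I + S\<close>, which reduces to surjectivity of
  \<open>I + \<gamma>A\<close> and \<open>I + \<gamma>B\<close>, that is, to Minty's theorem. For the latter, let \<open>C\<close> be the convex hull of
  \<open>{(y, v, \<langle>y, v\<rangle>) : v \<in> T y}\<close>. Monotonicity gives \<open>c \<ge> \<langle>y, v\<rangle>\<close> on \<open>C\<close>, so the function
  \<open>\<parallel>(y - v)/2\<parallel>\<^sup>2 + c \<ge> \<parallel>(y + v)/2\<parallel>\<^sup>2\<close> is nonnegative on \<open>C\<close>. By strong convexity the points \<open>(y - v)/2\<close>
  along a minimizing sequence converge, and the first-order condition at the limit \<open>x\<close> says that
  \<open>(x, -x)\<close> is monotonically related to the graph of \<open>T\<close>.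
\<close>

section \<open>Monotone graphs and their convex hulls\<close>

lemma maximal_monotoneD:
  assumes max: "maximal_monotone T"
    and rel: "\<And>y v. v \<in> T y \<Longrightarrow> (y - x) \<bullet> (v - u) \<ge> 0"
  shows "u \<in> T x"
proof -
  let ?T' = "T(x := insert u (T x))"
  have mon: "monotone_operator T"
    using max by (simp add: maximal_monotone_def)
  have sym: "(x - y) \<bullet> (u - v) \<ge> 0" if "v \<in> T y" for y v
    using rel[OF that] by (simp add: inner_diff_left inner_diff_right)
  have "monotone_operator ?T'"
    unfolding monotone_operator_def
  proof (intro allI impI)
    fix p q s t assume s: "s \<in> ?T' p" and t: "t \<in> ?T' q"
    have "s \<in> T p \<or> (p = x \<and> s = u)" "t \<in> T q \<or> (q = x \<and> t = u)"
      using s t by (auto split: if_splits)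
    then show "(p - q) \<bullet> (s - t) \<ge> 0"
      using mon rel sym by (auto simp: monotone_operator_def)
  qed
  moreover have "\<forall>z. T z \<subseteq> ?T' z"
    by auto
  ultimately have "?T' = T"
    using max unfolding maximal_monotone_def by blast
  then show ?thesis
    by (metis fun_upd_same insertI1)
qed

text \<open>Half-spaces are used twice. Each graph point gives a half-space that contains all
  generators, hence the hull and \<open>(y, v, c)\<close>. Read the other way, these inequalities
  say that the half-space given by \<open>(y, v, c)\<close> contains all generators, hence
  \<open>(y, v, c)\<close> itself, which is \<open>2 * (c - y \<bullet> v) \<ge> 0\<close>.\<close>

lemma monotone_hull_bound:
  fixes T :: "'h::real_inner \<Rightarrow> 'h set"
  assumes mon: "monotone_operator T"
    and w: "(y, v, c) \<in> convex hull {(y, v, y \<bullet> v) | y v. v \<in> T y}"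
  shows "y \<bullet> v \<le> c"
proof -
  let ?G = "{(y, v, y \<bullet> v) | y v. v \<in> T y}"
  have step: "convex hull ?G \<subseteq> {w. (- v', - y', 1) \<bullet> w \<ge> - c'}"
    if "\<And>y v. v \<in> T y \<Longrightarrow> c' + y \<bullet> v - y' \<bullet> v - y \<bullet> v' \<ge> 0" for y' v' :: 'h and c' :: real
    using that
    by (intro hull_minimal convex_halfspace_ge)
       (force simp: algebra_simps inner_commute)
  have 1: "y' \<bullet> v' + c - y' \<bullet> v - y \<bullet> v' \<ge> 0" if "v' \<in> T y'" for y' v'
  proof -
    have "y' \<bullet> v' + p \<bullet> q - y' \<bullet> q - p \<bullet> v' \<ge> 0" if "q \<in> T p" for p q
      using mon \<open>v' \<in> T y'\<close> that
      unfolding monotone_operator_def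
      by (smt (verit) inner_diff_left inner_diff_right)
    from subsetD[OF step[OF this] w] show ?thesis
      by (simp add: inner_commute)
  qed
  have "c + p \<bullet> q - y \<bullet> q - p \<bullet> v \<ge> 0" if "q \<in> T p" for p q
    using 1[OF that] by linarith
  from subsetD[OF step[OF this] w] show ?thesis
    by (simp add: inner_commute)
qed

section \<open>Minimizing sequences of a convex function in Hilbert space\<close>

lemma convex_combination_power2_norm:
  fixes p q :: "'h::real_inner"
  shows "(norm ((1 - t) *\<^sub>R p + t *\<^sub>R q))\<^sup>2
    = (norm p)\<^sup>2 + 2 * t * (p \<bullet> (q - p)) + t\<^sup>2 * (norm (q - p))\<^sup>2"
proof -
  have "(1 - t) *\<^sub>R p + t *\<^sub>R q = p + t *\<^sub>R (q - p)"
    by (simp add: algebra_simps)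
  then show ?thesis
    by (simp only: power2_norm_eq_inner)
       (simp add: inner_add_left inner_add_right inner_commute power2_eq_square algebra_simps)
qed

lemma quadratic_nonneg_slope:
  fixes A B :: real
  assumes "\<And>t. 0 < t \<Longrightarrow> t \<le> 1 \<Longrightarrow> t * A + t\<^sup>2 * B \<ge> 0"
  shows "A \<ge> 0"
proof (rule tendsto_lowerbound)
  show "((\<lambda>t. A + t * B) \<longlongrightarrow> A) (at_right 0)"
    by (auto intro!: tendsto_eq_intros)
  show "\<forall>\<^sub>F t in at_right 0. 0 \<le> A + t * B"
    unfolding eventually_at_right_field
  proof (intro exI[of _ 1] conjI allI impI)
    fix t :: real assume t: "0 < t" "t < 1"
    have "t * (A + t * B) \<ge> 0"
      using assms[of t] t by (simp add: power2_eq_square algebra_simps)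
    then show "0 \<le> A + t * B"
      using t by (simp add: zero_le_mult_iff)
  qed simp
qed simp

text \<open>The inequality is the optimality condition for minimizing
  \<open>h (p, c) = (norm p)^2 + c\<close>, weakened by dropping the infimum
  \<open>m \<ge> 0\<close>. As \<open>C\<close> need not be closed, the infimum need not be
  attained, and \<open>x\<close> is only a limit of first components.\<close>

lemma convex_minimizing_limit:
  fixes C :: "('h::{real_inner, complete_space} \<times> real) set"
  assumes conv: "convex C" and ne: "C \<noteq> {}"
    and nonneg: "\<And>p c. (p, c) \<in> C \<Longrightarrow> (norm p)\<^sup>2 + c \<ge> 0"
  obtains x where "\<And>p c. (p, c) \<in> C \<Longrightarrow> 2 * (x \<bullet> p) - (norm x)\<^sup>2 + c \<ge> 0"
proof -
  define h where "h w = (norm (fst w))\<^sup>2 + snd w" for w :: "'h \<times> real"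
  define m where "m = Inf (h ` C)"
  have bdd: "bdd_below (h ` C)"
    using nonneg by (intro bdd_belowI[of _ 0]) (auto simp: h_def)
  have m_le: "m \<le> h w" if "w \<in> C" for w
    unfolding m_def using bdd that by (simp add: cINF_lower)
  have m0: "m \<ge> 0"
    unfolding m_def using ne nonneg by (intro cINF_greatest) (auto simp: h_def)
  have "\<exists>w\<in>C. h w < m + 1 / Suc n" for n
    using cINF_less_iff[OF ne bdd, of "m + 1 / Suc n"] by (simp add: m_def)
  then obtain w where wC: "\<And>n. w n \<in> C" and wh: "\<And>n. h (w n) < m + 1 / Suc n"
    by metis
  have comb: "m \<le> (norm p)\<^sup>2 + 2 * t * (p \<bullet> (q - p)) + t\<^sup>2 * (norm (q - p))\<^sup>2 + (1 - t) * c + t * d"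
    if "(p, c) \<in> C" "(q, d) \<in> C" "0 \<le> t" "t \<le> 1" for p q c d t
  proof -
    have "(1 - t) *\<^sub>R (p, c) + t *\<^sub>R (q, d) \<in> C"
      using conv that by (intro convexD) auto
    from m_le[OF this] show ?thesis
      by (simp add: h_def convex_combination_power2_norm)
  qed
  \<comment> \<open>At the midpoint, \<open>h\<close> is the average of its two end values minus
    \<open>(norm (q - p))^2 / 4\<close>, yet still at least \<open>m\<close>; so two nearly minimal
    points are close.\<close>
  have gap: "(dist (fst (w i)) (fst (w j)))\<^sup>2 \<le> 2 * (1 / Suc i + 1 / Suc j)" for i j
  proof -
    obtain p c q d where eq: "w i = (p, c)" "w j = (q, d)"
      by (cases "w i", cases "w j")
    have "m \<le> (norm p)\<^sup>2 + p \<bullet> (q - p) + (norm (q - p))\<^sup>2 / 4 + c / 2 + d / 2"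
      using comb[of p c q d "1/2"] wC[of i] wC[of j] eq by (simp add: power2_eq_square)
    moreover have "(norm q)\<^sup>2 = (norm p)\<^sup>2 + 2 * (p \<bullet> (q - p)) + (norm (q - p))\<^sup>2"
      using convex_combination_power2_norm[of 1 p q] by simp
    moreover have "(norm p)\<^sup>2 + c < m + 1 / Suc i" "(norm q)\<^sup>2 + d < m + 1 / Suc j"
      using wh[of i] wh[of j] eq by (simp_all add: h_def)
    ultimately have "(norm (q - p))\<^sup>2 \<le> 2 * (1 / Suc i + 1 / Suc j)"
      by argo
    then show ?thesis
      using eq by (simp add: dist_norm norm_minus_commute)
  qed
  have "Cauchy (\<lambda>n. fst (w n))"
  proof (rule metric_CauchyI)
    fix e :: real assume "e > 0"
    \<comment> \<open>For indices from \<open>N\<close> on, \<open>gap\<close> is at most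
      \<open>4 / Suc N\<close>, hence the factor 4.\<close>
    then obtain N where N: "1 / Suc N < e\<^sup>2 / 4"
      using reals_Archimedean[of "e\<^sup>2 / 4"] by (auto simp: inverse_eq_divide)
    have "dist (fst (w i)) (fst (w j)) < e" if "i \<ge> N" "j \<ge> N" for i j
    proof (rule power_less_imp_less_base)
      have "1 / Suc i \<le> 1 / Suc N" "1 / Suc j \<le> 1 / Suc N"
        using that by (simp_all add: frac_le)
      then show "(dist (fst (w i)) (fst (w j)))\<^sup>2 < e\<^sup>2"
        using gap[of i j] N by argo
    qed (use \<open>e > 0\<close> in simp)
    then show "\<exists>M. \<forall>i\<ge>M. \<forall>j\<ge>M. dist (fst (w i)) (fst (w j)) < e"
      by blast
  qed
  then obtain x where x: "(\<lambda>n. fst (w n)) \<longlonglongrightarrow> x"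
    using Cauchy_convergent convergent_def by blast
  have "(\<lambda>n. h (w n)) \<longlonglongrightarrow> m"
  proof (rule tendsto_sandwich)
    show "\<forall>\<^sub>F n in sequentially. m \<le> h (w n)"
      using m_le wC by simp
    show "\<forall>\<^sub>F n in sequentially. h (w n) \<le> m + 1 / Suc n"
      using wh by (simp add: less_imp_le)
    show "(\<lambda>n. m + 1 / Suc n) \<longlonglongrightarrow> m"
      using tendsto_add[OF tendsto_const LIMSEQ_inverse_real_of_nat, of m]
      by (simp add: inverse_eq_divide)
  qed simp
  \<comment> \<open>Second components converge too, being \<open>h\<close> minus the squared norm of
    the first.\<close>
  then have "(\<lambda>n. h (w n) - (norm (fst (w n)))\<^sup>2) \<longlonglongrightarrow> m - (norm x)\<^sup>2"
    by (intro tendsto_intros x)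
  then have c: "(\<lambda>n. snd (w n)) \<longlonglongrightarrow> m - (norm x)\<^sup>2"
    by (simp add: h_def)
  show thesis
  proof
    fix q d assume q: "(q, d) \<in> C"
    \<comment> \<open>The limit point may lie outside \<open>C\<close>, so \<open>comb\<close> is
      applied along the sequence with \<open>t\<close> fixed; the limit in \<open>n\<close> is taken
      first, then \<open>t\<close> tends to 0.\<close>
    have "2 * (x \<bullet> (q - x)) + (norm x)\<^sup>2 - m + d \<ge> 0"
    proof (rule quadratic_nonneg_slope)
      fix t :: real assume t: "0 < t" "t \<le> 1"
      let ?f = "\<lambda>p c. (norm p)\<^sup>2 + 2 * t * (p \<bullet> (q - p)) + t\<^sup>2 * (norm (q - p))\<^sup>2
        + (1 - t) * c + t * d"
      have "(\<lambda>n. ?f (fst (w n)) (snd (w n))) \<longlonglongrightarrow> ?f x (m - (norm x)\<^sup>2)"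
        by (intro tendsto_intros x c)
      then have "m \<le> ?f x (m - (norm x)\<^sup>2)"
        by (rule LIMSEQ_le_const) (use comb q t wC in auto)
      then show "t * (2 * (x \<bullet> (q - x)) + (norm x)\<^sup>2 - m + d) + t\<^sup>2 * (norm (q - x))\<^sup>2 \<ge> 0"
        by (simp add: algebra_simps)
    qed
    then show "2 * (x \<bullet> q) - (norm x)\<^sup>2 + d \<ge> 0"
      using m0 by (simp add: inner_diff_right power2_norm_eq_inner)
  qed
qed

text \<open>With \<open>p = (y - v)/2\<close> and \<open>c = y \<bullet> v\<close>, the expression
  \<open>2 * (x \<bullet> p) - (norm x)^2 + c\<close> equals
  \<open>(y - x) \<bullet> (v + x)\<close>. The halved difference is chosen for this.\<close>

lemma monotone_extension_point:
  fixes T :: "'h::{real_inner, complete_space} \<Rightarrow> 'h set"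
  assumes mon: "monotone_operator T"
  obtains x where "\<And>y v. v \<in> T y \<Longrightarrow> (y - x) \<bullet> (v + x) \<ge> 0"
proof (cases "\<exists>y v. v \<in> T y")
  case False
  then show ?thesis
    using that by blast
next
  case True
  let ?G = "{(y, v, y \<bullet> v) | y v. v \<in> T y}"
  let ?f = "\<lambda>(y, v, c). ((1/2) *\<^sub>R (y - v), c) :: 'h \<times> real"
  have lin: "linear ?f"
    by (rule linearI) (auto simp: algebra_simps)
  have nonneg: "(norm p)\<^sup>2 + c \<ge> 0" if pc: "(p, c) \<in> ?f ` (convex hull ?G)" for p c
  proof -
    obtain y v where p: "p = (1/2) *\<^sub>R (y - v)" and w: "(y, v, c) \<in> convex hull ?G"
      using pc by auto
    have "(norm p)\<^sup>2 + y \<bullet> v = (norm ((1/2) *\<^sub>R (y + v)))\<^sup>2"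
      unfolding p power2_norm_eq_inner
      by (simp add: inner_diff_left inner_diff_right inner_add_left inner_add_right
          inner_commute field_simps)
    then have "(norm p)\<^sup>2 + y \<bullet> v \<ge> 0"
      by simp
    then show ?thesis
      using monotone_hull_bound[OF mon w] by linarith
  qed
  have "convex (?f ` (convex hull ?G))"
    by (intro convex_linear_image lin convex_convex_hull)
  moreover have "?f ` (convex hull ?G) \<noteq> {}"
    using True by auto
  ultimately obtain x
    where x: "\<And>p c. (p, c) \<in> ?f ` (convex hull ?G) \<Longrightarrow> 2 * (x \<bullet> p) - (norm x)\<^sup>2 + c \<ge> 0"
    using nonneg convex_minimizing_limit by blast
  show ?thesis
  proof
    fix y v assume "v \<in> T y"
    then have "(y, v, y \<bullet> v) \<in> convex hull ?G"
      by (intro hull_inc) blast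
    then have "((1/2) *\<^sub>R (y - v), y \<bullet> v) \<in> ?f ` (convex hull ?G)"
      by (rule rev_image_eqI) simp
    from x[OF this] show "(y - x) \<bullet> (v + x) \<ge> 0"
      by (simp add: inner_diff_left inner_diff_right inner_add_left inner_add_right
          inner_commute power2_norm_eq_inner field_simps)
  qed
qed

section \<open>Minty's theorem and its converse\<close>

theorem minty_surjective:
  fixes T :: "'h::{real_inner, complete_space} \<Rightarrow> 'h set"
  assumes max: "maximal_monotone T" and g: "\<gamma> > 0"
  obtains x u where "u \<in> T x" "x + \<gamma> *\<^sub>R u = w"
proof -
  \<comment> \<open>Scaling by \<gamma> and shifting by \<open>w\<close> turns the condition
    \<open>v = -x\<close> at the extension point into
    \<open>\<gamma> *\<^sub>R u = w - x\<close>.\<close>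
  let ?T = "\<lambda>y. (\<lambda>u. \<gamma> *\<^sub>R u - w) ` T y"
  have mon: "monotone_operator T"
    using max by (simp add: maximal_monotone_def)
  have "monotone_operator ?T"
    unfolding monotone_operator_def
  proof (clarify)
    fix y y' u u' assume "u \<in> T y" "u' \<in> T y'"
    then have "\<gamma> * ((y - y') \<bullet> (u - u')) \<ge> 0"
      using mon g by (simp add: monotone_operator_def)
    then show "(y - y') \<bullet> (\<gamma> *\<^sub>R u - w - (\<gamma> *\<^sub>R u' - w)) \<ge> 0"
      by (simp add: inner_diff_right algebra_simps)
  qed
  then obtain x where x: "\<And>y v. v \<in> ?T y \<Longrightarrow> (y - x) \<bullet> (v + x) \<ge> 0"
    using monotone_extension_point by blast
  define u where "u = (1 / \<gamma>) *\<^sub>R (w - x)"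
  have gu: "\<gamma> *\<^sub>R u = w - x"
    using g by (simp add: u_def)
  have "u \<in> T x"
  proof (rule maximal_monotoneD[OF max])
    fix y v assume "v \<in> T y"
    then have "(y - x) \<bullet> (\<gamma> *\<^sub>R v - w + x) \<ge> 0"
      using x by blast
    also have "\<gamma> *\<^sub>R v - w + x = \<gamma> *\<^sub>R (v - u)"
      using gu by (simp add: algebra_simps)
    finally show "(y - x) \<bullet> (v - u) \<ge> 0"
      using g by (simp add: zero_le_mult_iff)
  qed
  then show thesis
    using that gu by simp
qed

text \<open>A point \<open>(z, v)\<close> of an extension shares its sum \<open>z + v\<close> with
  some graph point \<open>(z', v')\<close>. Then \<open>(z - z') \<bullet> (v - v')\<close> is minus
  the square of \<open>norm (z - z')\<close>, so monotonicity makes the points equal.\<close>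

lemma maximal_monotone_if_surjective:
  assumes mon: "monotone_operator T"
    and surj: "\<And>w. \<exists>z v. v \<in> T z \<and> z + v = w"
  shows "maximal_monotone T"
  unfolding maximal_monotone_def
proof (intro conjI allI impI mon)
  fix T' assume mon': "monotone_operator T'" and sub: "\<forall>z. T z \<subseteq> T' z"
  have "T' z \<subseteq> T z" for z
  proof
    fix v assume v: "v \<in> T' z"
    obtain z' v' where z': "v' \<in> T z'" and eq: "z' + v' = z + v"
      using surj by blast
    have diff: "v - v' = - (z - z')"
      using eq by (simp add: algebra_simps)
    have "v' \<in> T' z'"
      using z' sub by blast
    with v mon' have "(z - z') \<bullet> (v - v') \<ge> 0"
      unfolding monotone_operator_def by blast
    then have "z = z'"
      unfolding diff inner_minus_right
      by (metis add.inverse_inverse inner_gt_zero_iff leD neg_0_le_iff_le right_minus_eq)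
    with eq z' show "v \<in> T z"
      by simp
  qed
  with sub show "T' = T"
    by (intro ext) blast
qed

section \<open>Enlargements and maximality of the operator S\<close>

lemma enlargement_S_operator:
  assumes mon: "monotone_operator A" and g: "\<gamma> > 0"
    and b: "b \<in> enlargement B \<epsilon> x" and a: "a \<in> A y"
    and eq: "\<gamma> *\<^sub>R a + y = x - \<gamma> *\<^sub>R b"
  shows "\<gamma> *\<^sub>R (a + b) \<in> enlargement (S_operator \<gamma> A B) (\<gamma> * \<epsilon>) (y + \<gamma> *\<^sub>R b)"
  unfolding enlargement_def S_operator_def S_graph_def
proof (clarify)
  fix x' y' a' b'
  assume b': "b' \<in> B x'" and a': "a' \<in> A y'" and eq': "\<gamma> *\<^sub>R a' + y' = x' - \<gamma> *\<^sub>R b'"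
  have A: "\<gamma> * ((y - y') \<bullet> (a - a')) \<ge> 0"
    using mon a a' g by (simp add: monotone_operator_def)
  have "(x - x') \<bullet> (b - b') \<ge> - \<epsilon>"
    using b b' by (simp add: enlargement_def)
  then have B: "\<gamma> * ((x - x') \<bullet> (b - b')) \<ge> - (\<gamma> * \<epsilon>)"
    using mult_left_mono[of "- \<epsilon>" _ \<gamma>] g by fastforce
  have x: "x - x' = (y - y') + \<gamma> *\<^sub>R (a - a') + \<gamma> *\<^sub>R (b - b')"
    using eq eq' by (simp add: algebra_simps)
  have d: "y + \<gamma> *\<^sub>R b - (y' + \<gamma> *\<^sub>R b') = (y - y') + \<gamma> *\<^sub>R (b - b')"
    "\<gamma> *\<^sub>R (a + b) - (\<gamma> *\<^sub>R a' + \<gamma> *\<^sub>R b') = \<gamma> *\<^sub>R (a - a') + \<gamma> *\<^sub>R (b - b')"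
    by (simp_all add: algebra_simps)
  have "(y + \<gamma> *\<^sub>R b - (y' + \<gamma> *\<^sub>R b')) \<bullet> (\<gamma> *\<^sub>R (a + b) - (\<gamma> *\<^sub>R a' + \<gamma> *\<^sub>R b'))
      = \<gamma> * ((y - y') \<bullet> (a - a')) + \<gamma> * ((x - x') \<bullet> (b - b'))"
    unfolding d x inner_add_left inner_add_right inner_scaleR_left inner_scaleR_right
    by (simp add: inner_commute[of "b - b'" "a - a'"] distrib_left)
  with A B show "(y + \<gamma> *\<^sub>R b - (y' + \<gamma> *\<^sub>R b')) \<bullet> (\<gamma> *\<^sub>R (a + b) - (\<gamma> *\<^sub>R a' + \<gamma> *\<^sub>R b'))
      \<ge> - (\<gamma> * \<epsilon>)"
    by linarith
qed

lemma monotone_S_operator: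
  assumes "monotone_operator A" "monotone_operator B" "\<gamma> > 0"
  shows "monotone_operator (S_operator \<gamma> A B)"
  unfolding monotone_operator_def
proof (intro allI impI)
  fix z z' v v'
  assume v: "v \<in> S_operator \<gamma> A B z" and v': "v' \<in> S_operator \<gamma> A B z'"
  obtain x y a b where *: "z = y + \<gamma> *\<^sub>R b" "v = \<gamma> *\<^sub>R (a + b)"
    "b \<in> B x" "a \<in> A y" "\<gamma> *\<^sub>R a + y = x - \<gamma> *\<^sub>R b"
    using v by (auto simp: S_operator_def S_graph_def scaleR_add_right)
  \<comment> \<open>Monotonicity of \<open>B\<close> places its graph in the enlargement with
    \<epsilon> = 0, so the enlargement inclusion specializes to monotonicity of S.\<close>
  have "b \<in> enlargement B 0 x"
    using assms(2) *(3) by (simp add: enlargement_def monotone_operator_def)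
  from enlargement_S_operator[OF assms(1,3) this *(4,5)] v'
  show "(z - z') \<bullet> (v - v') \<ge> 0"
    by (simp add: enlargement_def *(1,2))
qed

lemma maximal_monotone_S_operator:
  fixes A B :: "'h::{real_inner, complete_space} \<Rightarrow> 'h set"
  assumes A: "maximal_monotone A" and B: "maximal_monotone B" and g: "\<gamma> > 0"
  shows "maximal_monotone (S_operator \<gamma> A B)"
proof (rule maximal_monotone_if_surjective)
  show "monotone_operator (S_operator \<gamma> A B)"
    using A B g by (intro monotone_S_operator) (auto simp: maximal_monotone_def)
  fix w
  \<comment> \<open>An exact Douglas-Rachford step from \<open>w\<close>: the resolvent of \<gamma>B
    at \<open>w\<close>, then that of \<gamma>A at \<open>x - \<gamma> *\<^sub>R b\<close>.\<close>
  obtain x b where b: "b \<in> B x" "x + \<gamma> *\<^sub>R b = w"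
    using minty_surjective[OF B g] by blast
  obtain y a where a: "a \<in> A y" "y + \<gamma> *\<^sub>R a = x - \<gamma> *\<^sub>R b"
    using minty_surjective[OF A g] by blast
  have "\<gamma> *\<^sub>R a + \<gamma> *\<^sub>R b \<in> S_operator \<gamma> A B (y + \<gamma> *\<^sub>R b)"
    using a b unfolding S_operator_def S_graph_def
    by (auto simp: add.commute)
  moreover have "(y + \<gamma> *\<^sub>R b) + (\<gamma> *\<^sub>R a + \<gamma> *\<^sub>R b) = w"
    unfolding b(2)[symmetric] eq_diff_eq[THEN iffD1, OF a(2), symmetric]
    by (simp add: algebra_simps)
  ultimately show "\<exists>z v. v \<in> S_operator \<gamma> A B z \<and> z + v = w"
    by blast
qed

section \<open>Iterates between consecutive extragradient steps\<close>

lemma increasing_enumeration_gap: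
  assumes enum: "increasing_enumeration S kk" and j: "j \<in> index_set S"
    and k: "kk (j - 1) < k" "k < kk j"
  shows "k \<notin> S"
proof
  assume "k \<in> S"
  then obtain i where i: "i \<in> index_set S" "k = kk i"
    using enum unfolding increasing_enumeration_def by blast
  have sm: "strict_mono_on (insert 0 (index_set S)) kk"
    using enum by (simp add: increasing_enumeration_def)
  \<comment> \<open>For \<open>j = 1\<close> the predecessor is 0, outside
    \<open>index_set S\<close>; the inserted 0 covers this case.\<close>
  have "j - 1 \<in> insert 0 (index_set S)"
    using j by (auto simp: index_set_def)
  then have "j - 1 < i" "i < j"
    using k i j strict_mono_on_less[OF sm] by auto
  then show False
    by linarith
qed

lemma increasing_enumeration_step:
  assumes "increasing_enumeration S kk" "j \<in> index_set S"
  shows "kk j \<in> S" "kk (j - 1) < kk j"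
proof -
  show "kk j \<in> S"
    using assms by (auto simp: increasing_enumeration_def)
  have "j - 1 \<in> insert 0 (index_set S)" "j - 1 < j"
    using assms(2) by (auto simp: index_set_def)
  then show "kk (j - 1) < kk j"
    using assms by (auto simp: increasing_enumeration_def elim!: strict_mono_onD)
qed

lemma constant_on_null_steps:
  fixes f :: "nat \<Rightarrow> 'a"
  assumes "m \<le> n" "\<And>k. m < k \<Longrightarrow> k \<le> n \<Longrightarrow> f k = f (k - 1)"
  shows "f n = f m"
  using assms by (induction n rule: dec_induct) auto

section \<open>Extragradient steps as HPE iterations\<close>

theorem proposition3p2:
  fixes A B :: "'h::{real_inner, complete_space} \<Rightarrow> 'h set"
    and z0 :: 'h and \<gamma> \<tau>0 \<sigma> \<theta> :: real
    and z x b y a zt v :: "nat \<Rightarrow> 'h"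
    and \<epsilon>b \<tau> \<epsilon> :: "nat \<Rightarrow> real"
    and kk :: "nat \<Rightarrow> nat" and J :: "nat set"
  assumes "maximal_monotone A" and "maximal_monotone B"
    and "op_inverse (op_plus A B) 0 \<noteq> {}"
    and "\<gamma> > 0" and "\<tau>0 > 0" and "0 < \<sigma>" and "\<sigma> < 1" and "0 < \<theta>" and "\<theta> < 1"
    and "inexact_DR A B z0 \<gamma> \<tau>0 \<sigma> \<theta> z x b \<epsilon>b y a \<tau>"
    and "J = index_set (extragradient_steps \<gamma> \<sigma> z x b \<epsilon>b y)"
    and "increasing_enumeration (extragradient_steps \<gamma> \<sigma> z x b \<epsilon>b y) kk"
    and "\<And>j. j \<in> J \<Longrightarrow> zt (kk j) = y (kk j) + \<gamma> *\<^sub>R b (kk j)"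
    and "\<And>j. j \<in> J \<Longrightarrow> v (kk j) = \<gamma> *\<^sub>R (a (kk j) + b (kk j))"
    and "\<And>j. j \<in> J \<Longrightarrow> \<epsilon> (kk j) = \<gamma> * \<epsilon>b (kk j)"
  shows "(\<forall>j\<in>J.
            v (kk j) \<in> enlargement (S_operator \<gamma> A B) (\<epsilon> (kk j)) (zt (kk j)) \<and>
            (norm (v (kk j) + zt (kk j) - z (kk (j - 1))))\<^sup>2 + 2 * \<epsilon> (kk j)
              \<le> \<sigma>\<^sup>2 * (norm (zt (kk j) - z (kk (j - 1))))\<^sup>2 \<and>
            z (kk j) = z (kk (j - 1)) - v (kk j)) \<and>
         hpe_method (S_operator \<gamma> A B) \<sigma> z0 J (\<lambda>j. 1)
           (\<lambda>j. zt (kk j)) (\<lambda>j. v (kk j)) (\<lambda>j. \<epsilon> (kk j)) (\<lambda>j. z (kk j))"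
proof -
  let ?S = "S_operator \<gamma> A B"
  let ?E = "extragradient_steps \<gamma> \<sigma> z x b \<epsilon>b y"
  note g = \<open>\<gamma> > 0\<close> and J = \<open>J = index_set ?E\<close> and enum = \<open>increasing_enumeration ?E kk\<close>
  have monA: "monotone_operator A"
    using \<open>maximal_monotone A\<close> by (simp add: maximal_monotone_def)
  note DR = \<open>inexact_DR A B z0 \<gamma> \<tau>0 \<sigma> \<theta> z x b \<epsilon>b y a \<tau>\<close>[unfolded inexact_DR_def]
  have main: "v (kk j) \<in> enlargement ?S (\<epsilon> (kk j)) (zt (kk j)) \<and>
      (norm (v (kk j) + zt (kk j) - z (kk (j - 1))))\<^sup>2 + 2 * \<epsilon> (kk j)
        \<le> \<sigma>\<^sup>2 * (norm (zt (kk j) - z (kk (j - 1))))\<^sup>2 \<and>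
      z (kk j) = z (kk (j - 1)) - v (kk j) \<and> \<epsilon> (kk j) \<ge> 0"
    if jJ: "j \<in> J" for j
  proof -
    let ?k = "kk j"
    have j: "j \<in> index_set ?E"
      using jJ J by simp
    note step = increasing_enumeration_step[OF enum j]
    have k1: "?k \<ge> 1" and test: "extragradient_test \<gamma> \<sigma> z x b \<epsilon>b y ?k"
      using step(1) by (simp_all add: extragradient_steps_def)
    have k: "\<epsilon>b ?k \<ge> 0" "b ?k \<in> enlargement B (\<epsilon>b ?k) (x ?k)" "a ?k \<in> A (y ?k)"
      "\<gamma> *\<^sub>R a ?k + y ?k = x ?k - \<gamma> *\<^sub>R b ?k" "z ?k = z (?k - 1) - \<gamma> *\<^sub>R (a ?k + b ?k)"
      using DR k1 test by auto
    \<comment> \<open>The algorithm compares with the preceding iterate, HPE with the iterate at the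
      preceding extragradient step; only null steps lie between.\<close>
    have prev: "z (?k - 1) = z (kk (j - 1))"
    proof (rule constant_on_null_steps)
      show "kk (j - 1) \<le> ?k - 1"
        using step(2) by simp
      fix i assume i: "kk (j - 1) < i" "i \<le> ?k - 1"
      then have "i \<notin> ?E" "i \<ge> 1"
        using increasing_enumeration_gap[OF enum j] by auto
      then show "z i = z (i - 1)"
        using DR by (simp add: extragradient_steps_def)
    qed
    note defs = assms(13-15)[OF jJ]
    \<comment> \<open>This makes the HPE residual the left side of the extragradient test.\<close>
    have sum: "v ?k + zt ?k = \<gamma> *\<^sub>R b ?k + x ?k"
      using k(4) by (simp add: defs algebra_simps)
    show ?thesis
    proof (intro conjI)
      show "v ?k \<in> enlargement ?S (\<epsilon> ?k) (zt ?k)"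
        unfolding defs by (rule enlargement_S_operator[OF monA g k(2-4)])
      show "(norm (v ?k + zt ?k - z (kk (j - 1))))\<^sup>2 + 2 * \<epsilon> ?k
          \<le> \<sigma>\<^sup>2 * (norm (zt ?k - z (kk (j - 1))))\<^sup>2"
        using test unfolding extragradient_test_def sum prev
        by (simp add: defs add.commute mult.assoc)
      show "z ?k = z (kk (j - 1)) - v ?k"
        using k(5) prev by (simp add: defs)
      show "\<epsilon> ?k \<ge> 0"
        using k(1) g by (simp add: defs)
    qed
  qed
  have "maximal_monotone ?S"
    using assms(1,2) g by (rule maximal_monotone_S_operator)
  moreover have "z (kk 0) = z0"
    using enum DR by (simp add: increasing_enumeration_def)
  moreover have "\<forall>j\<in>J. 1 \<le> j \<and> {1..j} \<subseteq> J"
    by (auto simp: J index_set_def)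
  ultimately have "hpe_method ?S \<sigma> z0 J (\<lambda>j. 1)
      (\<lambda>j. zt (kk j)) (\<lambda>j. v (kk j)) (\<lambda>j. \<epsilon> (kk j)) (\<lambda>j. z (kk j))"
    using main \<open>0 < \<sigma>\<close> \<open>\<sigma> < 1\<close> by (simp add: hpe_method_def)
  with main show ?thesis
    by blast
qed

end
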